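(* Let $d$ be an integer with $d=126$ or $d\ge 253$. Then \[ q_d^{(2)}(n)\ \ge\ Q_d^{(2)}(n) \] holds for all non-negative integers $n$, except for $n=d+1$, $n=d+3$, or $n=d+5$ when $d$ is odd. (That is: if $d$ is even the inequality holds for all $n\ge 0$; if $d$ is odd it holds for all $n\ge 0$ with $n\notin\{d+1,d+3,d+5\}$.)
   Context: A partition of a positive integer $n$ is an unordered tuple (multiset) $(\pi_1,\dots,\pi_k)$ of positive integers, called its parts, with $\pi_1+\cdots+\pi_k=n$; the integer $0$ has exactly one partition, the empty one, which satisfies every condition on parts. For positive integers $a,b,d$ and an integer $n\ge 0$: $q_d^{(a)}(n)$ denotes the number of partitions of $n$ in which every part is $\ge a$ and any two parts (at different positions of the tuple) differ by at least $d$; $Q_d^{(b)}(n)$ denotes the number of partitions of $n$ in which every part is congruent to $b$ or to $-b$ modulo $d+3$ (repeated parts allowed). *)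

theory Defs
  imports Complex_Main "HOL-Library.Multiset" "HOL-Number_Theory.Cong"
begin

definition partitions :: "nat \<Rightarrow> nat multiset set" where
  "partitions n = {P. 0 \<notin># P \<and> \<Sum>\<^sub># P = n}"

text \<open>The sub-multiset \<open>{#x, y#}\<close> stands for a choice of two positions of \<open>P\<close>, so a part
  occurring twice is compared with itself and violates the condition when \<open>d > 0\<close>.\<close>

definition differ_by_at_least :: "nat \<Rightarrow> nat multiset \<Rightarrow> bool" where
  "differ_by_at_least d P \<longleftrightarrow>
     (\<forall>x y. {#x, y#} \<subseteq># P \<longrightarrow> \<bar>int x - int y\<bar> \<ge> int d)"

definition q :: "nat \<Rightarrow> nat \<Rightarrow> nat \<Rightarrow> nat" where
  "q d a n = card {P \<in> partitions n. (\<forall>x \<in># P. x \<ge> a) \<and> differ_by_at_least d P}"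

definition Q :: "nat \<Rightarrow> nat \<Rightarrow> nat \<Rightarrow> nat" where
  "Q d b n = card {P \<in> partitions n. \<forall>x \<in># P.
     [int x = int b] (mod (int d + 3)) \<or> [int x = - int b] (mod (int d + 3))}"

text \<open>The cardinalities above are those of finite sets.\<close>

lemma finite_partitions: "finite (partitions n)"
proof (rule finite_subset)
  show "partitions n \<subseteq> mset ` {xs. set xs \<subseteq> {..n} \<and> length xs \<le> n}"
  proof
    fix P assume "P \<in> partitions n"
    then have pos: "0 \<notin># P" and sum: "\<Sum>\<^sub># P = n"
      by (auto simp: partitions_def)
    obtain xs where xs: "P = mset xs"
      by (metis ex_mset)
    have "set xs \<subseteq> {..n}"
      using sum xs member_le_sum_list[of _ xs] by (auto simp: sum_mset_sum_list)
    moreover have "length ys \<le> sum_list ys" if "0 \<notin> set ys" for ys :: "nat list"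
      using that by (induction ys) auto
    from this[of xs] have "length xs \<le> n"
      using pos sum xs by (metis set_mset_mset sum_mset_sum_list)
    ultimately show "P \<in> mset ` {xs. set xs \<subseteq> {..n} \<and> length xs \<le> n}"
      using xs by blast
  qed
  show "finite (mset ` {xs. set xs \<subseteq> {..n} \<and> length xs \<le> n})"
    by (intro finite_imageI finite_lists_length_le) simp
qed

end

theory Submission
  imports Defs "HOL-Combinatorics.Multiset_Permutations"
begin

text \<open>
  The inequality has so much room that crude bounds suffice for every \<open>d \<ge> 126\<close>.
  Adding the staircase \<open>2, d + 2, 2d + 2, \<dots>\<close> to the partitions of \<open>N\<close> into at most
  \<open>j + 1\<close> parts gives at least \<open>N ^ j / (j! (j + 1)!)\<close> partitions counted by \<open>q\<close>, where
  \<open>n = 2(j + 1) + d j(j + 1)/2 + N\<close>. A partition counted by \<open>Q\<close> is determined by its parts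
  other than 2; giving \<open>k(d + 3) \<plusminus> 2\<close> the weight \<open>k\<close>, these have total weight at most
  \<open>m = n div (d + 1)\<close>. So \<open>Q \<le> t ^ (- m) (\<Prod>k\<le>m. 1 - t ^ k) ^ (- 2)\<close> for all \<open>0 < t < 1\<close>.
  For fixed \<open>m\<close> the second bound does not involve \<open>d\<close> and the first one grows with \<open>d\<close>, so one
  may take \<open>d = 126\<close> and choose \<open>j\<close> and \<open>t\<close> in terms of \<open>m\<close>: for \<open>4K\<^sup>2 \<le> m \<le> 4(K + 1)\<^sup>2\<close> with \<open>K \<ge> 6\<close> one can take \<open>j = 2K - 1\<close> and
  \<open>t = K / (K + 1)\<close>, for \<open>2 \<le> m \<le> 149\<close> a few explicit values do, and \<open>m \<le> 1\<close> is counted by hand.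
\<close>

section \<open>Lower bound for \<open>q\<close> by adding a staircase\<close>

fun stair :: "nat \<Rightarrow> nat \<Rightarrow> nat list \<Rightarrow> nat list" where
  "stair d s [] = []"
| "stair d s (x # xs) = (s + x) # stair d (s + d) xs"

text \<open>The lower bound \<open>c\<close> of the entries is carried along because the head
  becomes the new bound in the recursive call. With \<open>c = 0\<close> it bounds all parts from
  below; with \<open>c\<close> the preceding entry it gives the gaps.\<close>

lemma stair_ge:
  assumes "sorted (c # xs)" "y \<in> set (stair d s xs)"
  shows "s + c \<le> y"
  using assms
proof (induction xs arbitrary: s c)
  case (Cons x xs)
  have "c \<le> x" using Cons.prems by simp
  show ?case
  proof (cases "y = s + x")
    case False
    then have "s + d + x \<le> y" using Cons by simp
    then show ?thesis using \<open>c \<le> x\<close> by linarith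
  qed (use \<open>c \<le> x\<close> in simp)
qed simp

lemma stair_sorted_wrt: "sorted xs \<Longrightarrow> sorted_wrt (\<lambda>x y. x + d \<le> y) (stair d s xs)"
proof (induction xs arbitrary: s)
  case (Cons x xs)
  then show ?case using stair_ge[of x xs _ d "s + d"] by (fastforce simp: algebra_simps)
qed simp

lemma stair_inject:
  "length xs = length ys \<Longrightarrow> stair d s xs = stair d s ys \<longleftrightarrow> xs = ys"
  by (induction xs ys arbitrary: s rule: list_induct2) auto

text \<open>The offsets form an arithmetic progression, so \<open>d\<close> is multiplied by a
  triangular number.\<close>

lemma sum_list_stair:
  "sum_list (stair d s xs) = sum_list xs + s * length xs + d * (length xs * (length xs - 1) div 2)"
proof (induction xs arbitrary: s)
  case (Cons x xs)
  have "Suc k * k div 2 = k + k * (k - 1) div 2" for k :: nat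
    by (cases k) (auto simp: algebra_simps)
  then show ?case using Cons by (simp add: algebra_simps)
qed simp

lemma differ_by_at_least_mset:
  "sorted_wrt (\<lambda>x y. x + d \<le> y) xs \<Longrightarrow> differ_by_at_least d (mset xs)"
proof (induction xs)
  case Nil
  then show ?case by (simp add: differ_by_at_least_def)
next
  case (Cons a xs)
  show ?case
    unfolding differ_by_at_least_def
  proof (intro allI impI)
    fix x y assume sub: "{#x, y#} \<subseteq># mset (a # xs)"
    consider "x = a" "y \<in> set xs" | "y = a" "x \<in> set xs" | "{#x, y#} \<subseteq># mset xs"
    proof (cases "x = a \<or> y = a")
      case True
      \<comment> \<open>The pair is written with \<open>a\<close> in front so that one copy of
        \<open>a\<close> cancels; what remains is the other position, which must then lie in the
        tail even when both values equal \<open>a\<close>.\<close>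
      then have "{#x, y#} = add_mset a {#if x = a then y else x#}" by auto
      then have "(if x = a then y else x) \<in> set xs"
        using sub by (simp only: mset.simps mset_subset_eq_add_mset_cancel single_subset_iff set_mset_mset)
      then show ?thesis using True that by (auto split: if_splits)
    next
      case False
      have "{#x, y#} - {#a#} \<subseteq># mset xs"
        using sub by (simp add: subset_eq_diff_conv)
      then show ?thesis using False that(3) by (simp add: diff_add_mset_swap)
    qed
    then show "int d \<le> \<bar>int x - int y\<bar>"
      using Cons by cases (fastforce simp: differ_by_at_least_def)+
  qed
qed

lemma finite_q_set:
  "finite {P \<in> partitions n. (\<forall>x \<in># P. x \<ge> a) \<and> differ_by_at_least d P}"
  by (rule finite_subset[OF _ finite_partitions[of n]]) auto

lemma sorted_stair: "sorted xs \<Longrightarrow> sorted (stair d s xs)"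
  using stair_sorted_wrt[of xs d s] by (auto intro: sorted_wrt_mono_rel[rotated])

text \<open>The right-hand side is the product \<open>(N + 1) * ... * (N + j)\<close>, each factor
  of which is at least \<open>N\<close>.\<close>

lemma power_le_fact_binomial: "N ^ j \<le> fact j * ((N + j) choose j)"
proof (induction j)
  case (Suc j)
  have "N ^ Suc j \<le> (N + Suc j) * (fact j * ((N + j) choose j))"
    unfolding power_Suc using Suc by (intro mult_mono) auto
  also have "\<dots> = fact (Suc j) * ((N + Suc j) choose Suc j)"
    using Suc_times_binomial_eq[of "N + j" j] by (simp add: algebra_simps)
  finally show ?case .
qed simp

text \<open>There are \<open>(N + j) choose j\<close> ordered tuples of \<open>j + 1\<close> natural
  numbers with sum \<open>N\<close>, and a multiset underlies at most \<open>fact (Suc j)\<close> of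
  them. Sorting a multiset and adding the staircase is an injection into the partitions counted by
  \<open>q\<close>.\<close>

lemma q_lower:
  assumes n: "n = 2 * Suc j + d * (Suc j * j div 2) + N"
  shows "N ^ j \<le> q d 2 n * (fact j * fact (Suc j))"
proof -
  \<comment> \<open>Zeros are allowed in \<open>A\<close>: they pad partitions into at most
    \<open>j + 1\<close> parts to size exactly \<open>j + 1\<close>.\<close>
  define M where "M = {A :: nat multiset. size A = Suc j \<and> \<Sum>\<^sub># A = N}"
  define S where "S = {l :: nat list. length l = Suc j \<and> sum_list l = N}"
  define h where "h A = mset (stair d 2 (sorted_list_of_multiset A))" for A
  have sorted: "sorted (sorted_list_of_multiset A)" for A :: "nat multiset"
    by simp
  have sz: "length (sorted_list_of_multiset A) = size A" for A :: "nat multiset"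
    by (metis mset_sorted_list_of_multiset size_mset)
  have "h ` M \<subseteq> {P \<in> partitions n. (\<forall>x \<in># P. x \<ge> 2) \<and> differ_by_at_least d P}"
  proof
    fix P assume "P \<in> h ` M"
    then obtain A where A: "A \<in> M" "P = h A" by blast
    have ge: "2 \<le> x" if "x \<in># P" for x
      using stair_ge[of 0 "sorted_list_of_multiset A" x d 2] that A by (auto simp: h_def)
    have "sum_list (sorted_list_of_multiset A) = N"
      using A by (metis (mono_tags, lifting) M_def mem_Collect_eq mset_sorted_list_of_multiset sum_mset_sum_list)
    then have "\<Sum>\<^sub># P = n"
      using A by (simp add: h_def sum_mset_sum_list sum_list_stair sz M_def n algebra_simps)
    moreover have "differ_by_at_least d P"
      unfolding A(2) h_def by (intro differ_by_at_least_mset stair_sorted_wrt sorted)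
    ultimately show "P \<in> {P \<in> partitions n. (\<forall>x \<in># P. x \<ge> 2) \<and> differ_by_at_least d P}"
      using ge by (force simp: partitions_def)
  qed
  moreover have "inj_on h M"
  proof (rule inj_onI)
    fix A B assume AB: "A \<in> M" "B \<in> M" "h A = h B"
    \<comment> \<open>Both staircase lists are sorted, so equality of their multisets forces
      equality of the lists.\<close>
    have "stair d 2 (sorted_list_of_multiset A) = stair d 2 (sorted_list_of_multiset B)"
      using AB(3) sorted_stair[OF sorted]
      by (metis h_def sorted_list_of_multiset_mset sorted_sort_id)
    then have "sorted_list_of_multiset A = sorted_list_of_multiset B"
      using AB by (subst (asm) stair_inject) (simp_all add: sz M_def)
    then show "A = B" by (metis mset_sorted_list_of_multiset)
  qed
  ultimately have M_le: "card M \<le> q d 2 n" and finM: "finite M"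
    unfolding q_def
    by (auto intro: card_inj_on_le[OF _ _ finite_q_set] inj_on_finite[OF _ _ finite_q_set])
  have "S \<subseteq> (\<Union>A\<in>M. permutations_of_multiset A)"
    by (auto simp: S_def M_def permutations_of_multiset_def sum_mset_sum_list)
  then have "card S \<le> card (\<Union>A\<in>M. permutations_of_multiset A)"
    using finM by (intro card_mono) auto
  also have "\<dots> \<le> (\<Sum>A\<in>M. card (permutations_of_multiset A))"
    using finM by (rule card_UN_le)
  also have "\<dots> \<le> (\<Sum>A\<in>M. fact (Suc j))"
    by (intro sum_mono) (simp add: M_def card_permutations_of_multiset(1) del: fact_Suc)
  also have "\<dots> \<le> q d 2 n * fact (Suc j)"
    using M_le by (simp del: fact_Suc)
  finally have "(N + j) choose j \<le> q d 2 n * fact (Suc j)"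
    unfolding S_def card_length_sum_list using binomial_symmetric[of N "N + j"] by simp
  then have "fact j * ((N + j) choose j) \<le> fact j * (q d 2 n * fact (Suc j))"
    by (rule mult_le_mono2)
  also have "\<dots> = q d 2 n * (fact j * fact (Suc j))" by (simp only: ac_simps)
  finally have "fact j * ((N + j) choose j) \<le> q d 2 n * (fact j * fact (Suc j))" .
  then show ?thesis using power_le_fact_binomial[of N j] by linarith
qed

section \<open>Counting multisets of bounded weight\<close>

text \<open>Induction on \<open>W\<close> and \<open>m\<close>: either \<open>w\<close> does not occur in \<open>B\<close>, or one copy of it can be removed.\<close>

lemma weighted_multisets_bound:
  fixes t :: real
  assumes "finite W" "\<And>w. w \<in> W \<Longrightarrow> 0 < f w" and t: "0 < t" "t < 1"
  shows "finite {B. set_mset B \<subseteq> W \<and> (\<Sum>w\<in>#B. f w) \<le> m} \<and>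
    card {B. set_mset B \<subseteq> W \<and> (\<Sum>w\<in>#B. f w) \<le> m} * t ^ m * (\<Prod>w\<in>W. 1 - t ^ f w) \<le> 1"
  using assms(1,2)
proof (induction W arbitrary: m rule: finite_induct)
  case empty
  have "{B. set_mset B \<subseteq> {} \<and> (\<Sum>w\<in>#B. f w) \<le> m} = {{#}}" by auto
  then show ?case using t by (simp add: power_le_one)
next
  case (insert w W)
  define S where "S W m = {B. set_mset B \<subseteq> W \<and> (\<Sum>w\<in>#B. f w) \<le> m}" for W m
  define P where "P = (\<Prod>w\<in>W. 1 - t ^ f w)"
  have P0: "0 \<le> P"
    unfolding P_def using t by (intro prod_nonneg) (auto simp: power_le_one)
  have fw: "0 < f w" using insert.prems by simp
  have tw: "0 \<le> 1 - t ^ f w" using t by (simp add: power_le_one)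
  have IH: "finite (S W m)" "card (S W m) * t ^ m * P \<le> 1" for m
    using insert.IH[of m] insert.prems by (auto simp: S_def P_def)
  have "finite (S (insert w W) m) \<and> card (S (insert w W) m) * t ^ m * (P * (1 - t ^ f w)) \<le> 1"
  proof (induction m rule: less_induct)
    case (less m)
    \<comment> \<open>\<open>R\<close> covers the multisets that contain \<open>w\<close>; it is
      empty when a single copy already exceeds the weight bound.\<close>
    define R where "R = (if f w \<le> m then add_mset w ` S (insert w W) (m - f w) else {})"
    have sub: "S (insert w W) m \<subseteq> S W m \<union> R"
    proof
      fix B assume B: "B \<in> S (insert w W) m"
      show "B \<in> S W m \<union> R"
      proof (cases "w \<in># B")
        case True
        then obtain C where C: "B = add_mset w C" by (metis mset_add)
        then have "f w \<le> m" "C \<in> S (insert w W) (m - f w)" using B by (auto simp: S_def)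
        then show ?thesis using C by (auto simp: R_def)
      qed (use B in \<open>auto simp: S_def\<close>)
    qed
    \<comment> \<open>Lowering the bound to \<open>m - f w\<close> gains the factor
      \<open>t ^ f w\<close>. Together with the share \<open>1 - t ^ f w\<close> of the multisets
      avoiding \<open>w\<close> this adds up to 1.\<close>
    have R: "finite R \<and> card R * t ^ m * (P * (1 - t ^ f w)) \<le> t ^ f w"
    proof (cases "f w \<le> m")
      case True
      then have lt: "m - f w < m" using fw by simp
      have "card R \<le> card (S (insert w W) (m - f w))"
        using True less[OF lt] by (simp add: R_def card_image_le)
      moreover have tm: "t ^ m = t ^ (m - f w) * t ^ f w"
        using True by (simp flip: power_add)
      ultimately have "card R * t ^ m * (P * (1 - t ^ f w))
          \<le> card (S (insert w W) (m - f w)) * t ^ m * (P * (1 - t ^ f w))"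
        using t P0 tw by (intro mult_right_mono) auto
      also have "\<dots>
          = (card (S (insert w W) (m - f w)) * t ^ (m - f w) * (P * (1 - t ^ f w))) * t ^ f w"
        by (simp add: tm)
      also have "\<dots> \<le> 1 * t ^ f w"
        using less[OF lt] t by (intro mult_right_mono) auto
      finally show ?thesis using True less[OF lt] by (simp add: R_def)
    qed (use t in \<open>simp add: R_def\<close>)
    have "card (S (insert w W) m) \<le> card (S W m \<union> R)"
      using sub R IH by (intro card_mono) auto
    also have "\<dots> \<le> card (S W m) + card R" by (rule card_Un_le)
    finally have "real (card (S (insert w W) m)) \<le> card (S W m) + card R" by linarith
    then have "card (S (insert w W) m) * (t ^ m * (P * (1 - t ^ f w)))
        \<le> (card (S W m) + card R) * (t ^ m * (P * (1 - t ^ f w)))"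
      using t P0 tw by (intro mult_right_mono) auto
    also have "\<dots> = (card (S W m) * t ^ m * P) * (1 - t ^ f w) + card R * t ^ m * (P * (1 - t ^ f w))"
      by (simp add: algebra_simps)
    also have "\<dots> \<le> 1 * (1 - t ^ f w) + t ^ f w"
      using IH R tw by (intro add_mono mult_right_mono) auto
    finally show ?case
      using finite_subset[OF sub] R IH by (simp add: mult.assoc)
  qed
  then show ?case
    unfolding S_def P_def using insert.hyps by (simp add: mult_ac)
qed


section \<open>Lower bounds for the products of \<open>1 - t ^ k\<close>, uniform in the number of
  factors\<close>

lemma prod_one_minus_power_split:
  fixes t :: "'a :: comm_ring_1"
  shows "(\<Prod>k<J + i. 1 - t ^ Suc k) = (\<Prod>k<J. 1 - t ^ Suc k) * (\<Prod>k<i. 1 - t ^ (J + Suc k))"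
  by (induction i) (simp_all add: mult.assoc)

lemma prod_one_minus_power_antimono:
  fixes t :: real
  assumes "0 \<le> t" "t \<le> 1" "M \<le> J"
  shows "(\<Prod>k<J. 1 - t ^ Suc k) \<le> (\<Prod>k<M. 1 - t ^ Suc k)"
proof -
  obtain i where J: "J = M + i" using assms(3) le_Suc_ex by blast
  have "(\<Prod>k<i. 1 - t ^ (M + Suc k)) \<le> 1"
    using assms by (intro prod_le_1) (auto simp: power_le_one simp del: power_Suc)
  moreover have "0 \<le> (\<Prod>k<M. 1 - t ^ Suc k)"
    using assms by (intro prod_nonneg) (auto simp: power_le_one simp del: power_Suc)
  ultimately show ?thesis
    unfolding J prod_one_minus_power_split by (rule mult_left_le)
qed

lemma sum_power_tail_le:
  fixes t :: real
  assumes "0 < t" "t < 1"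
  shows "(\<Sum>k<i. t ^ (J + Suc k)) \<le> t ^ Suc J / (1 - t)"
proof -
  have "(\<Sum>k<i. t ^ (J + Suc k)) = t ^ Suc J * (\<Sum>k<i. t ^ k)"
    by (simp add: sum_distrib_left power_add mult_ac)
  also have "(\<Sum>k<i. t ^ k) = (1 - t ^ i) / (1 - t)"
    using assms by (subst geometric_sum) (auto simp: field_simps)
  also have "t ^ Suc J * \<dots> \<le> t ^ Suc J * (1 / (1 - t))"
    using assms by (intro mult_left_mono divide_right_mono) auto
  finally show ?thesis by simp
qed

lemma prod_one_minus_ge:
  fixes x :: "nat \<Rightarrow> real"
  assumes "\<And>k. 0 \<le> x k" "\<And>k. x k \<le> 1"
  shows "1 - (\<Sum>k<i. x k) \<le> (\<Prod>k<i. 1 - x k)"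
proof (induction i)
  case (Suc i)
  have "(\<Prod>k<i. 1 - x k) \<le> 1" using assms by (intro prod_le_1) auto
  then have "(\<Prod>k<i. 1 - x k) * x i \<le> 1 * x i"
    using assms by (intro mult_right_mono) auto
  then show ?case using Suc by (simp add: algebra_simps)
qed simp

text \<open>The first \<open>J\<close> factors are kept exact. The later ones are estimated by one
  minus the sum of their powers, a geometric tail, which makes numerical evaluation possible for all
  \<open>M\<close> at once.\<close>

lemma prod_one_minus_power_ge:
  fixes t :: real
  assumes t: "0 < t" "t < 1"
  shows "(\<Prod>k<J. 1 - t ^ Suc k) * (1 - t ^ Suc J / (1 - t)) \<le> (\<Prod>k<M. 1 - t ^ Suc k)"
proof -
  have "1 - t ^ Suc J / (1 - t) \<le> 1 - (\<Sum>k<M. t ^ (J + Suc k))"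
    using sum_power_tail_le[OF t] by simp
  also have "\<dots> \<le> (\<Prod>k<M. 1 - t ^ (J + Suc k))"
    using t by (intro prod_one_minus_ge) (auto simp: power_le_one simp del: power_Suc)
  finally have "(\<Prod>k<J. 1 - t ^ Suc k) * (1 - t ^ Suc J / (1 - t))
      \<le> (\<Prod>k<J. 1 - t ^ Suc k) * (\<Prod>k<M. 1 - t ^ (J + Suc k))"
    using t by (intro mult_left_mono prod_nonneg) (auto simp: power_le_one simp del: power_Suc)
  also have "\<dots> = (\<Prod>k<J + M. 1 - t ^ Suc k)"
    by (simp only: prod_one_minus_power_split)
  also have "\<dots> \<le> (\<Prod>k<M. 1 - t ^ Suc k)"
    using t by (intro prod_one_minus_power_antimono) auto
  finally show ?thesis .
qed

text \<open>The quadratic estimate of \<open>exp\<close> at \<open>1 / 64\<close> is raised to the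
  power 64. The value \<open>11 / 4\<close> combines with a later factor 4 to the integer
  11.\<close>

lemma exp_1_le: "exp 1 \<le> (11 / 4 :: real)"
proof -
  have "exp (1 / 64 :: real) \<le> 1 + 1 / 64 + (1 / 64)\<^sup>2" by (rule exp_bound) auto
  then have "exp (1 / 64 :: real) ^ 64 \<le> (1 + 1 / 64 + (1 / 64)\<^sup>2) ^ 64"
    by (intro power_mono) auto
  also have "\<dots> \<le> 11 / 4" by (simp add: power2_eq_square field_simps)
  finally show ?thesis by (simp flip: exp_of_nat_mult)
qed

text \<open>\<open>ln (1 - x) >= - x - 2 * x^2\<close>, and \<open>2 * x^2 <= x\<close> on this
  range.\<close>

lemma exp_le_one_minus: "0 \<le> x \<Longrightarrow> x \<le> 1 / 2 \<Longrightarrow> exp (- 2 * x) \<le> 1 - (x :: real)"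
proof -
  assume x: "0 \<le> x" "x \<le> 1 / 2"
  have "x * x \<le> x * (1 / 2)" using x by (intro mult_left_mono) auto
  then have "- 2 * x \<le> ln (1 - x)"
    using ln_one_minus_pos_lower_bound[OF x] by (simp add: power2_eq_square)
  then show ?thesis using x by (simp add: ln_ge_iff)
qed

lemma prod_ratio_binomial:
  "(\<Prod>k<j. real (Suc k) / real (K + Suc k)) * real ((K + j) choose j) = 1"
proof (induction j)
  case (Suc j)
  have "real (Suc j) * real ((K + Suc j) choose Suc j) = real (K + Suc j) * real ((K + j) choose j)"
    using Suc_times_binomial[of j "K + j"] by (simp del: of_nat_Suc of_nat_add flip: of_nat_mult)
  then have "real (Suc j) / real (K + Suc j) * real ((K + Suc j) choose Suc j) = real ((K + j) choose j)"
    by (simp add: field_simps del: of_nat_Suc of_nat_add)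
  then show ?case using Suc by (simp only: prod.lessThan_Suc mult.assoc)
qed simp

text \<open>Reciprocal of Bernoulli's inequality for \<open>(1 + 1 / K) ^ k\<close>.\<close>

lemma power_ratio_le:
  assumes "0 < K"
  shows "(real K / real (Suc K)) ^ k \<le> real K / real (K + k)"
proof -
  have "1 + real k * (1 / real K) \<le> (1 + 1 / real K) ^ k"
    by (rule Bernoulli_inequality) (simp add: order_trans[of _ 0])
  then have "1 / (1 + 1 / real K) ^ k \<le> 1 / (1 + real k * (1 / real K))"
    using assms by (intro divide_left_mono mult_pos_pos zero_less_power) (auto intro!: add_pos_nonneg)
  moreover have "real K / real (Suc K) = 1 / (1 + 1 / real K)"
    "real K / real (K + k) = 1 / (1 + real k * (1 / real K))"
    using assms by (auto simp: field_simps)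
  ultimately show ?thesis by (simp add: power_one_over)
qed

text \<open>The factors below \<open>K\<close> are compared with those of \<open>1 / (2K choose K) \<ge> 1 / 4 ^ K\<close>; in the
  others \<open>t ^ k \<le> 1 / 2\<close>, and they contribute at least \<open>exp (- K)\<close>.\<close>

lemma prod_one_minus_power_ratio_ge:
  assumes "0 < K"
  shows "(1 / 11) ^ K \<le> (\<Prod>k<M. 1 - (real K / real (Suc K)) ^ Suc k)"
proof -
  define t where "t = real K / real (Suc K)"
  have t: "0 < t" "t < 1" using assms by (auto simp: t_def)
  have tK: "t ^ K \<le> 1 / 2"
    using power_ratio_le[OF assms, of K] assms by (simp add: t_def)
  have "(1 / 4) ^ K = (1 :: real) / 2 ^ (K + K)"
    by (simp add: power_one_over power_add flip: power_mult_distrib)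
  also have "\<dots> \<le> 1 / real ((K + K) choose K)"
  proof -
    have "(K + K) choose K \<le> 2 ^ (K + K)" by (rule binomial_le_pow2)
    then have "real ((K + K) choose K) \<le> 2 ^ (K + K)" by (metis of_nat_le_iff of_nat_numeral of_nat_power)
    then show ?thesis by (intro divide_left_mono) auto
  qed
  also have "\<dots> = (\<Prod>k<K. real (Suc k) / real (K + Suc k))"
    using prod_ratio_binomial[of K K] by (auto simp: field_simps simp del: of_nat_Suc of_nat_add)
  also have "\<dots> \<le> (\<Prod>k<K. 1 - t ^ Suc k)"
  proof (intro prod_mono conjI)
    fix k
    have "real (Suc k) / real (K + Suc k) = 1 - real K / real (K + Suc k)"
      by (simp add: field_simps)
    then show "real (Suc k) / real (K + Suc k) \<le> 1 - t ^ Suc k"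
      using power_ratio_le[OF assms, of "Suc k"] unfolding t_def by linarith
  qed auto
  finally have head: "(1 / 4) ^ K \<le> (\<Prod>k<K. 1 - t ^ Suc k)" .
  have "(\<Sum>k<M. t ^ (K + Suc k)) \<le> t ^ Suc K / (1 - t)"
    by (rule sum_power_tail_le[OF t])
  \<comment> \<open>For this \<open>t\<close> the ratio \<open>t / (1 - t)\<close> equals
    \<open>K\<close>.\<close>
  also have "\<dots> = real K * t ^ K"
  proof -
    have "1 - t = 1 / real (Suc K)" "t * real (Suc K) = real K"
      by (simp_all add: t_def field_simps)
    then show ?thesis by (simp add: mult_ac del: of_nat_Suc)
  qed
  also have "\<dots> \<le> real K * (1 / 2)" using tK by (intro mult_left_mono) auto
  finally have sum: "(\<Sum>k<M. t ^ (K + Suc k)) \<le> real K / 2"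
    by simp
  \<comment> \<open>\<open>4 / 11\<close> is a rational lower bound for \<open>exp (- 1)\<close>;
    with \<open>1 / 4\<close> from the first \<open>K\<close> factors it produces
    \<open>1 / 11\<close>.\<close>
  have "(4 / 11) ^ K \<le> exp (- 1 :: real) ^ K"
    using exp_1_le by (intro power_mono) (auto simp: exp_minus field_simps)
  also have "\<dots> = exp (- real K)" by (simp flip: exp_of_nat_mult)
  also have "\<dots> \<le> exp (\<Sum>k<M. - 2 * t ^ (K + Suc k))"
    using sum by (simp only: flip: sum_distrib_left) simp
  also have "\<dots> = (\<Prod>k<M. exp (- 2 * t ^ (K + Suc k)))" by (simp add: exp_sum)
  also have "\<dots> \<le> (\<Prod>k<M. 1 - t ^ (K + Suc k))"
  proof (intro prod_mono conjI exp_le_one_minus)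
    fix k
    have "t ^ (K + Suc k) \<le> t ^ K" using t by (intro power_decreasing) auto
    then show "t ^ (K + Suc k) \<le> 1 / 2" using tK by simp
  qed (use t in auto)
  finally have tail: "(4 / 11) ^ K \<le> (\<Prod>k<M. 1 - t ^ (K + Suc k))" .
  have "(1 / 11) ^ K = (1 / 4) ^ K * ((4 / 11) ^ K :: real)"
    by (simp flip: power_mult_distrib)
  also have "\<dots> \<le> (\<Prod>k<K. 1 - t ^ Suc k) * (\<Prod>k<M. 1 - t ^ (K + Suc k))"
    using head tail t by (intro mult_mono prod_nonneg) (auto simp: power_le_one simp del: power_Suc)
  also have "\<dots> = (\<Prod>k<K + M. 1 - t ^ Suc k)"
    by (simp only: prod_one_minus_power_split)
  also have "\<dots> \<le> (\<Prod>k<M. 1 - t ^ Suc k)"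
    using t by (intro prod_one_minus_power_antimono) auto
  finally show ?thesis unfolding t_def .
qed

section \<open>Upper bound for \<open>Q\<close> through the parts other than 2\<close>

text \<open>The admissible parts \<open>k * (d + 3) - 2\<close> and \<open>k * (d + 3) + 2\<close>
  with \<open>1 <= k <= m\<close>. The part 2, which would belong to \<open>k = 0\<close>, is left
  out.\<close>

definition Q_parts :: "nat \<Rightarrow> nat \<Rightarrow> nat set" where
  "Q_parts d m = (\<lambda>k. Suc k * (d + 3) - 2) ` {..<m} \<union> (\<lambda>k. Suc k * (d + 3) + 2) ` {..<m}"

text \<open>Recovers the multiplier \<open>k\<close>: adding 2 to such a part gives
  \<open>k * (d + 3)\<close> or \<open>k * (d + 3) + 4\<close>, and \<open>4 < d + 3\<close> once
  \<open>2 <= d\<close>.\<close>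

definition part_index :: "nat \<Rightarrow> nat \<Rightarrow> nat" where
  "part_index d w = (w + 2) div (d + 3)"

lemma part_index_simps:
  assumes "2 \<le> d"
  shows "part_index d (Suc k * (d + 3) - 2) = Suc k" "part_index d (Suc k * (d + 3) + 2) = Suc k"
proof -
  have "Suc k * (d + 3) - 2 + 2 = Suc k * (d + 3)" by simp
  then show "part_index d (Suc k * (d + 3) - 2) = Suc k"
    unfolding part_index_def by (metis nonzero_mult_div_cancel_right add_is_0 zero_neq_numeral)
  have "Suc k * (d + 3) + 2 + 2 = 4 + Suc k * (d + 3)" by simp
  then show "part_index d (Suc k * (d + 3) + 2) = Suc k"
    unfolding part_index_def using assms by (simp only: div_mult_self1 div_less)
qed

text \<open>Each weight \<open>k\<close> belongs to exactly two parts, one for each sign, hence the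
  square.\<close>

lemma prod_Q_parts:
  fixes t :: real
  assumes "2 \<le> d"
  shows "(\<Prod>w\<in>Q_parts d m. 1 - t ^ part_index d w) = (\<Prod>k<m. 1 - t ^ Suc k)\<^sup>2"
proof -
  let ?f = "\<lambda>k. Suc k * (d + 3) - 2" and ?g = "\<lambda>k. Suc k * (d + 3) + 2"
  have inj: "inj ?f" "inj ?g"
    by (rule inj_on_inverseI[of _ "\<lambda>w. part_index d w - 1"], simp only: part_index_simps[OF assms] diff_Suc_1)+
  have "?f k \<noteq> ?g l" for k l
  proof
    assume eq: "?f k = ?g l"
    then have "k = l" using part_index_simps[OF assms] by (metis Suc_inject)
    then show False using eq by simp
  qed
  then have "?f ` {..<m} \<inter> ?g ` {..<m} = {}" by blast
  then have "(\<Prod>w\<in>Q_parts d m. 1 - t ^ part_index d w)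
      = (\<Prod>w\<in>?f ` {..<m}. 1 - t ^ part_index d w) * (\<Prod>w\<in>?g ` {..<m}. 1 - t ^ part_index d w)"
    unfolding Q_parts_def by (intro prod.union_disjoint) auto
  also have "\<dots> = (\<Prod>k<m. 1 - t ^ Suc k) * (\<Prod>k<m. 1 - t ^ Suc k)"
    using inj by (subst (1 2) prod.reindex)
      (auto intro: inj_on_subset simp only: o_def part_index_simps[OF assms] subset_UNIV)
  finally show ?thesis by (simp only: power2_eq_square)
qed

lemma Q_part_cases:
  assumes "2 \<le> d" "0 < x"
    and "[int x = int 2] (mod (int d + 3)) \<or> [int x = - int 2] (mod (int d + 3))"
  shows "x = 2 \<or> (\<exists>k. x = Suc k * (d + 3) - 2 \<or> x = Suc k * (d + 3) + 2)"
  using assms(3)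
proof
  assume "[int x = int 2] (mod (int d + 3))"
  then have "[int x = int 2] (mod int (d + 3))" by simp
  then have "x mod (d + 3) = 2" using assms(1) unfolding cong_int_iff by (simp add: cong_def)
  then have x: "x = x div (d + 3) * (d + 3) + 2" by (metis div_mult_mod_eq)
  then show ?thesis
    by (cases "x div (d + 3)") (metis add_0 mult_0, metis)
next
  assume "[int x = - int 2] (mod (int d + 3))"
  then have "int d + 3 dvd int x - - int 2" by (simp only: cong_iff_dvd_diff)
  then have "int (d + 3) dvd int (x + 2)" by (simp add: add.commute)
  then have "d + 3 dvd x + 2" unfolding of_nat_dvd_iff .
  then obtain c where c: "x + 2 = (d + 3) * c" by (elim dvdE)
  then obtain k where "c = Suc k" by (cases c) auto
  then have "x = Suc k * (d + 3) - 2" using c by (metis add_diff_cancel_right' mult.commute)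
  then show ?thesis by blast
qed

text \<open>Since \<open>k >= 1\<close>, even the smaller part \<open>k * (d + 3) - 2\<close> is at
  least \<open>k * (d + 1)\<close>. This bounds the total weight by
  \<open>n div (d + 1)\<close>.\<close>

lemma part_index_le:
  assumes "2 \<le> d" "w \<in> Q_parts d m"
  shows "part_index d w * (d + 1) \<le> w"
  using assms(2) unfolding Q_parts_def
proof (elim UnE imageE)
  fix k assume w: "w = Suc k * (d + 3) - 2"
  show ?thesis
    unfolding w part_index_simps[OF assms(1)] by (simp add: algebra_simps)
next
  fix k assume w: "w = Suc k * (d + 3) + 2"
  show ?thesis
    unfolding w part_index_simps[OF assms(1)] by (simp add: algebra_simps)
qed

lemma part_index_pos: "2 \<le> d \<Longrightarrow> w \<in> Q_parts d m \<Longrightarrow> 0 < part_index d w"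
  unfolding Q_parts_def by (elim UnE imageE) (simp_all only: part_index_simps zero_less_Suc)

text \<open>Deleting all copies of 2 is injective, because \<open>n\<close> determines how many
  there were. The conditions on \<open>n - \<Sum>\<^sub># B\<close> record that the rest consists of
  2s; they matter for the direct count when \<open>n < 2 * (d + 1)\<close>.\<close>

lemma Q_le_card:
  fixes d n :: nat
  assumes d: "2 \<le> d"
  defines "m \<equiv> n div (d + 1)"
  defines "X \<equiv> {B. set_mset B \<subseteq> Q_parts d m \<and> (\<Sum>w\<in>#B. part_index d w) \<le> m
    \<and> \<Sum>\<^sub># B \<le> n \<and> even (n - \<Sum>\<^sub># B)}"
  shows "finite X \<and> Q d 2 n \<le> card X"
proof -
  let ?A = "{P \<in> partitions n. \<forall>x \<in># P.
     [int x = int 2] (mod (int d + 3)) \<or> [int x = - int 2] (mod (int d + 3))}"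
  define g where "g = filter_mset (\<lambda>x :: nat. x \<noteq> 2)"
  have split: "P = g P + replicate_mset (count P 2) 2" for P
    by (auto simp: multiset_eq_iff g_def)
  have sum: "\<Sum>\<^sub># P = \<Sum>\<^sub># (g P) + 2 * count P 2" for P
  proof -
    have "\<Sum>\<^sub># P = \<Sum>\<^sub># (g P + replicate_mset (count P 2) 2)"
      using split[of P] by (rule arg_cong)
    then show ?thesis by (simp only: sum_mset.union sum_mset_replicate_mset of_nat_id mult.commute)
  qed
  have "g ` ?A \<subseteq> X"
  proof
    fix B assume "B \<in> g ` ?A"
    then obtain P where P: "P \<in> ?A" "B = g P" by blast
    then have n: "n = \<Sum>\<^sub># B + 2 * count P 2" using sum[of P] by (simp add: partitions_def)
    have B: "set_mset B \<subseteq> Q_parts d m"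
    proof
      fix x assume x: "x \<in># B"
      then have "x \<in># P" "x \<noteq> 2" using P by (auto simp: g_def)
      then have "0 < x" using P by (auto simp: partitions_def intro: gr0I)
      then obtain k where k: "x = Suc k * (d + 3) - 2 \<or> x = Suc k * (d + 3) + 2"
        using Q_part_cases[OF d] P \<open>x \<in># P\<close> \<open>x \<noteq> 2\<close> by blast
      have "x \<le> n" using multi_member_split[OF x] n by auto
      then have "Suc k * (d + 1) \<le> n" using k by (auto simp: algebra_simps)
      then have "Suc k \<le> m" unfolding m_def by (simp only: less_eq_div_iff_mult_less_eq zero_less_Suc Suc_eq_plus1[symmetric])
      then show "x \<in> Q_parts d m" using k by (auto simp: Q_parts_def)
    qed
    have "(\<Sum>w\<in>#C. part_index d w) * (d + 1) \<le> \<Sum>\<^sub># C" if "set_mset C \<subseteq> Q_parts d m" for C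
      using that
    proof (induction C)
      case (add w C)
      then show ?case using part_index_le[OF d, of w m] by (simp add: algebra_simps)
    qed simp
    from this[OF B] have "(\<Sum>w\<in>#B. part_index d w) * (d + 1) \<le> n" using n by linarith
    then have "(\<Sum>w\<in>#B. part_index d w) \<le> m"
      unfolding m_def by (simp add: less_eq_div_iff_mult_less_eq)
    then show "B \<in> X" using B n by (simp add: X_def)
  qed
  moreover have "inj_on g ?A"
  proof (rule inj_onI)
    fix P P' assume "P \<in> ?A" "P' \<in> ?A" "g P = g P'"
    moreover from this have "count P 2 = count P' 2"
      using sum[of P] sum[of P'] by (simp add: partitions_def)
    ultimately show "P = P'" using split[of P] split[of P'] by simp
  qed
  moreover have "finite X"
  proof (rule finite_subset)
    show "X \<subseteq> {B. set_mset B \<subseteq> Q_parts d m \<and> (\<Sum>w\<in>#B. part_index d w) \<le> m}"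
      by (auto simp: X_def)
    \<comment> \<open>Any \<open>t\<close> strictly between 0 and 1 would do here; only finiteness
      is extracted.\<close>
    show "finite \<dots>"
      using weighted_multisets_bound[of "Q_parts d m" "part_index d" "1 / 2" m] part_index_pos[OF d]
      by (simp add: Q_parts_def)
  qed
  ultimately show ?thesis unfolding Q_def by (auto intro: card_inj_on_le)
qed

lemma Q_upper:
  fixes t :: real and d n :: nat
  assumes d: "2 \<le> d" and t: "0 < t" "t < 1"
  defines "m \<equiv> n div (d + 1)"
  shows "Q d 2 n * t ^ m * (\<Prod>k<m. 1 - t ^ Suc k)\<^sup>2 \<le> 1"
proof -
  let ?Y = "{B. set_mset B \<subseteq> Q_parts d m \<and> (\<Sum>w\<in>#B. part_index d w) \<le> m}"
  have fin: "finite (Q_parts d m)" by (simp add: Q_parts_def)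
  have "finite ?Y \<and> card ?Y * t ^ m * (\<Prod>w\<in>Q_parts d m. 1 - t ^ part_index d w) \<le> 1"
    by (rule weighted_multisets_bound[OF fin _ t]) (rule part_index_pos[OF d])
  then have Y: "finite ?Y" "card ?Y * t ^ m * (\<Prod>k<m. 1 - t ^ Suc k)\<^sup>2 \<le> 1"
    unfolding prod_Q_parts[OF d] by blast+
  have "Q d 2 n \<le> card {B. set_mset B \<subseteq> Q_parts d m \<and> (\<Sum>w\<in>#B. part_index d w) \<le> m
    \<and> \<Sum>\<^sub># B \<le> n \<and> even (n - \<Sum>\<^sub># B)}"
    using Q_le_card[OF d, of n] by (simp add: m_def)
  also have "\<dots> \<le> card ?Y" using Y(1) by (intro card_mono) auto
  finally have "Q d 2 n * (t ^ m * (\<Prod>k<m. 1 - t ^ Suc k)\<^sup>2) \<le> card ?Y * (t ^ m * (\<Prod>k<m. 1 - t ^ Suc k)\<^sup>2)"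
    using t by (intro mult_right_mono) auto
  then show ?thesis using Y(2) by (simp add: mult.assoc)
qed

section \<open>Comparison of the two bounds for \<open>n >= 2 * (d + 1)\<close>\<close>

text \<open>Reduces a whole range of \<open>m = n div (d + 1)\<close> to one numerical inequality
  free of \<open>d\<close> and \<open>n\<close>. Here \<open>p\<close> bounds the product, and
  \<open>a\<close> bounds the \<open>N\<close> of \<open>q_lower\<close> from below: with
  \<open>T\<close> the triangular number,
  \<open>n >= lo * (d + 1) >= d * T + 126 * (lo - T) + lo\<close>.\<close>

lemma Q_le_q_block:
  fixes t p :: real
  assumes d: "126 \<le> d" and t: "0 < t" "t < 1"
    and p: "0 \<le> p" "\<And>M. p \<le> (\<Prod>k<M. 1 - t ^ Suc k)"
    and m: "lo \<le> n div (d + 1)" "n div (d + 1) \<le> hi"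
    and j: "Suc j * j div 2 \<le> lo"
    and a: "a + 2 * Suc j \<le> 126 * (lo - Suc j * j div 2) + lo"
    and le: "fact j * fact (Suc j) \<le> t ^ hi * p\<^sup>2 * real a ^ j"
  shows "Q d 2 n \<le> q d 2 n"
proof -
  define T where "T = Suc j * j div 2"
  obtain r where r: "lo = T + r" using j le_Suc_ex T_def by blast
  define N where "N = n - 2 * Suc j - d * T"
  have "lo * (d + 1) \<le> n" using m(1) by (simp add: less_eq_div_iff_mult_less_eq)
  then have "d * T + d * r + (T + r) \<le> n" unfolding r by (simp add: algebra_simps)
  moreover have "126 * r \<le> d * r" using d by (rule mult_le_mono1)
  moreover have "a + 2 * Suc j \<le> 126 * r + (T + r)"
    using a[folded T_def] unfolding r by simp
  ultimately have ge: "2 * Suc j + d * T + a \<le> n" by linarith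
  then have n: "n = 2 * Suc j + d * (Suc j * j div 2) + N" "a \<le> N"
    by (auto simp: N_def T_def)
  have "a ^ j \<le> q d 2 n * (fact j * fact (Suc j))"
    using q_lower[OF n(1)] power_mono[OF n(2), of j] by linarith
  then have "real (a ^ j) \<le> real (q d 2 n * (fact j * fact (Suc j)))"
    by (rule of_nat_mono)
  then have qa: "real a ^ j \<le> q d 2 n * (fact j * fact (Suc j))"
    by (simp del: fact_Suc)
  have "Q d 2 n * t ^ hi * p\<^sup>2
      \<le> Q d 2 n * t ^ (n div (d + 1)) * (\<Prod>k<n div (d + 1). 1 - t ^ Suc k)\<^sup>2"
    using t p m(2) by (intro mult_mono power_mono power_decreasing) auto
  also have "\<dots> \<le> 1" using d t by (intro Q_upper) auto
  finally have Q1: "Q d 2 n * t ^ hi * p\<^sup>2 \<le> 1" .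
  have "real (Q d 2 n) * (fact j * fact (Suc j)) \<le> Q d 2 n * (t ^ hi * p\<^sup>2 * real a ^ j)"
    using le by (intro mult_left_mono) auto
  also have "\<dots> = (Q d 2 n * t ^ hi * p\<^sup>2) * real a ^ j" by simp
  also have "\<dots> \<le> 1 * real a ^ j" using Q1 by (intro mult_right_mono) auto
  also have "\<dots> \<le> q d 2 n * (fact j * fact (Suc j))" using qa by simp
  finally have "real (Q d 2 n) * (fact j * fact (Suc j)) \<le> real (q d 2 n) * (fact j * fact (Suc j))"
    by (simp only: of_nat_mult of_nat_fact)
  then show ?thesis
    by (simp del: fact_Suc)
qed

text \<open>Numerical core of the range \<open>m >= 144\<close>, for \<open>K = i + 1\<close> and
  \<open>j = 2 * i + 1\<close>. Passing from \<open>i\<close> to \<open>i + 1\<close>, with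
  \<open>x = i + 1\<close>, multiplies the left side by at most \<open>16 * (x + 1)^4 * 4^7\<close>
  and the right side by at least \<open>4 * (256 * (x + 1)^2)^2\<close>; these two factors are
  equal.\<close>

lemma factorial_growth:
  assumes "5 \<le> i"
  shows "fact (2 * i + 1) * fact (2 * i + 2) * 121 ^ (i + 1) * (11 / 4) ^ (4 * i + 13)
    \<le> (256 * real (i + 1) ^ 2) ^ (2 * i + 1)"
  using assms
proof (induction i rule: dec_induct)
  case base
  show ?case by (simp add: fact_numeral power_divide)
next
  case (step i)
  let ?x = "real i + 1"
  define A :: real where "A = fact (2 * i + 1) * fact (2 * i + 2) * 121 ^ (i + 1) * (11 / 4) ^ (4 * i + 13)"
  define B where "B = (256 * ?x ^ 2) ^ (2 * i + 1)"
  have AB: "A \<le> B" using step.IH by (simp add: A_def B_def add.commute)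
  \<comment> \<open>Bernoulli supplies the spare factor 4 in the growth of the right side.\<close>
  have "1 + real (4 * i + 2) * (1 / ?x) \<le> (1 + 1 / ?x) ^ (4 * i + 2)"
    by (rule Bernoulli_inequality) (simp add: order_trans[of _ 0])
  moreover have "3 \<le> real (4 * i + 2) * (1 / ?x)"
    using step.hyps by (simp add: field_simps)
  ultimately have "4 \<le> (1 + 1 / ?x) ^ (4 * i + 2)" by linarith
  then have "4 * ?x ^ (4 * i + 2) \<le> (1 + 1 / ?x) ^ (4 * i + 2) * ?x ^ (4 * i + 2)"
    by (intro mult_right_mono) auto
  also have "\<dots> = (?x + 1) ^ (4 * i + 2)"
  proof -
    have "(1 + 1 / ?x) * ?x = ?x + 1" by (simp add: field_simps)
    then show ?thesis by (simp only: flip: power_mult_distrib)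
  qed
  finally have pow: "4 * ?x ^ (2 * (2 * i + 1)) \<le> (?x + 1) ^ (2 * (2 * i + 1))" by (simp add: algebra_simps)
  have "4 * B = 256 ^ (2 * i + 1) * (4 * ?x ^ (2 * (2 * i + 1)))"
    by (simp only: B_def power_mult_distrib power_mult mult_ac)
  also have "\<dots> \<le> 256 ^ (2 * i + 1) * (?x + 1) ^ (2 * (2 * i + 1))"
    using pow by (intro mult_left_mono) auto
  also have "\<dots> = (256 * (?x + 1) ^ 2) ^ (2 * i + 1)"
    by (simp only: power_mult_distrib power_mult)
  finally have B: "4 * B \<le> (256 * (?x + 1) ^ 2) ^ (2 * i + 1)" .
  have f: "(fact (2 * Suc i + 1) :: real) = (2 * ?x + 1) * (2 * ?x) * fact (2 * i + 1)"
    "(fact (2 * Suc i + 2) :: real) = (2 * ?x + 2) * (2 * ?x + 1) * fact (2 * i + 2)"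
    by (simp_all add: algebra_simps)
  have "(2 * ?x + 1) * (2 * ?x) * ((2 * ?x + 2) * (2 * ?x + 1))
      \<le> (2 * (?x + 1)) * (2 * (?x + 1)) * ((2 * (?x + 1)) * (2 * (?x + 1)))"
    by (intro mult_mono) auto
  also have "\<dots> = 16 * (?x + 1) ^ 4" by (simp add: power4_eq_xxxx algebra_simps)
  finally have c: "(2 * ?x + 1) * (2 * ?x) * ((2 * ?x + 2) * (2 * ?x + 1)) \<le> 16 * (?x + 1) ^ 4" .
  have "fact (2 * Suc i + 1) * fact (2 * Suc i + 2) * 121 ^ (Suc i + 1) * (11 / 4) ^ (4 * Suc i + 13)
      = ((2 * ?x + 1) * (2 * ?x) * ((2 * ?x + 2) * (2 * ?x + 1))) * (121 * (11 / 4) ^ 4) * A"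
    unfolding f A_def by (simp add: power_add power_divide)
  also have "\<dots> \<le> (16 * (?x + 1) ^ 4) * (4 ^ 7) * B"
    by (intro mult_mono[OF mult_mono[OF c] AB]) (auto simp: A_def power_divide)
  also have "\<dots> = (256 * (?x + 1) ^ 2) ^ 2 * (4 * B)"
    by (simp add: power_mult_distrib)
  also have "\<dots> \<le> (256 * (?x + 1) ^ 2) ^ 2 * (256 * (?x + 1) ^ 2) ^ (2 * i + 1)"
    using B by (intro mult_left_mono) auto
  also have "\<dots> = (256 * real (Suc i + 1) ^ 2) ^ (2 * Suc i + 1)"
    by (simp add: add.commute flip: power_add)
  finally show ?case .
qed

lemma Q_le_q_large:
  assumes d: "126 \<le> d" and m: "144 \<le> n div (d + 1)"
  shows "Q d 2 n \<le> q d 2 n"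
proof -
  let ?m = "n div (d + 1)"
  define K where "K = (LEAST K. ?m < 4 * (K + 1)\<^sup>2)"
  have "?m < 4 * (?m + 1)\<^sup>2" by (simp add: power2_eq_square)
  then have hi: "?m < 4 * (K + 1)\<^sup>2" unfolding K_def by (rule LeastI)
  have K6: "6 \<le> K"
  proof (rule ccontr)
    assume "\<not> 6 \<le> K"
    then have "(K + 1)\<^sup>2 \<le> 6\<^sup>2" by (intro power_mono) auto
    then show False using hi m by simp
  qed
  define i where "i = K - 1"
  have i: "K = i + 1" "5 \<le> i" using K6 by (auto simp: i_def)
  have lo: "4 * K\<^sup>2 \<le> ?m"
    using not_less_Least[of i "\<lambda>K. ?m < 4 * (K + 1)\<^sup>2"] i(1) unfolding K_def[symmetric] by simp
  define t where "t = real K / real (Suc K)"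
  have t: "0 < t" "t < 1" using K6 by (auto simp: t_def)
  \<comment> \<open>\<open>t >= exp (- 1 / K)\<close>, and
    \<open>4 * (K + 1)^2 / K = 4 * K + 8 + 4 / K\<close> is at most
    \<open>4 * K + 9 = 4 * i + 13\<close>.\<close>
  have "(4 / 11) ^ (4 * i + 13) \<le> exp (- 1 :: real) ^ (4 * i + 13)"
    using exp_1_le by (intro power_mono) (auto simp: exp_minus field_simps)
  also have "\<dots> = exp (- real (4 * i + 13))" by (simp flip: exp_of_nat_mult)
  also have "\<dots> \<le> exp (real (4 * (K + 1)\<^sup>2) * (- 1 / real K))"
  proof -
    have "4 * (K + 1)\<^sup>2 \<le> (4 * i + 13) * K"
      using i(2) by (simp add: i(1) power2_eq_square algebra_simps)
    then have "real (4 * (K + 1)\<^sup>2) \<le> real (4 * i + 13) * real K"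
      by (metis of_nat_le_iff of_nat_mult)
    then have "real (4 * (K + 1)\<^sup>2) / real K \<le> real (4 * i + 13)"
      using K6 by (simp only: pos_divide_le_eq of_nat_0_less_iff)
    then show ?thesis by (simp only: exp_le_cancel_iff mult_minus_right times_divide_eq_right mult_1_right divide_minus_left minus_divide_left[symmetric] neg_le_iff_le)
  qed
  also have "\<dots> = exp (- 1 / real K) ^ (4 * (K + 1)\<^sup>2)"
    by (rule exp_of_nat_mult)
  also have "\<dots> \<le> t ^ (4 * (K + 1)\<^sup>2)"
  proof (intro power_mono)
    have "1 / exp (1 / real K) \<le> 1 / (1 + 1 / real K)"
      using K6 by (intro divide_left_mono exp_ge_add_one_self) (auto intro!: add_pos_pos mult_pos_pos)
    moreover have "1 / (1 + 1 / real K) = t"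
      using K6 by (simp add: t_def field_simps)
    ultimately show "exp (- 1 / real K) \<le> t"
      by (simp add: exp_minus inverse_eq_divide)
  qed auto
  finally have tp: "(4 / 11) ^ (4 * i + 13) \<le> t ^ (4 * (K + 1)\<^sup>2)" .
  show ?thesis
  proof (rule Q_le_q_block[OF d t _ _ lo less_imp_le[OF hi]])
    show "(1 / 11) ^ K \<le> (\<Prod>k<M. 1 - t ^ Suc k)" for M
      unfolding t_def using K6 by (intro prod_one_minus_power_ratio_ge) auto
    have T: "Suc (2 * i + 1) * (2 * i + 1) div 2 = (i + 1) * (2 * i + 1)"
      by simp
    show "Suc (2 * i + 1) * (2 * i + 1) div 2 \<le> 4 * K\<^sup>2"
      unfolding T i(1) by (simp add: power2_eq_square algebra_simps)
    have "4 * K\<^sup>2 - (i + 1) * (2 * i + 1) = (i + 1) * (2 * i + 3)"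
      unfolding i(1) by (simp add: power2_eq_square algebra_simps)
    \<comment> \<open>The triangular number is \<open>K * (2 * K - 1)\<close>, leaving
      \<open>K * (2 * K + 1)\<close>. So the right side is \<open>256 * K^2 + 126 * K\<close>, and
      \<open>126 * K\<close> absorbs the \<open>4 * K\<close> on the left.\<close>
    then show "256 * K\<^sup>2 + 2 * Suc (2 * i + 1)
        \<le> 126 * (4 * K\<^sup>2 - Suc (2 * i + 1) * (2 * i + 1) div 2) + 4 * K\<^sup>2"
      unfolding T by (simp add: i(1) power2_eq_square algebra_simps)
    \<comment> \<open>Inserting mutually inverse powers exposes the left side of
      \<open>factorial_growth\<close>; 121 is the square of the 11 in the product bound.\<close>
    have "fact (2 * i + 1) * fact (Suc (2 * i + 1))
        = (4 / 11) ^ (4 * i + 13) * (1 / 121) ^ K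
          * (fact (2 * i + 1) * fact (2 * i + 2) * 121 ^ (i + 1) * (11 / 4 :: real) ^ (4 * i + 13))"
    proof -
      have "(4 / 11) ^ (4 * i + 13) * (11 / 4 :: real) ^ (4 * i + 13) = 1"
        "(1 / 121) ^ K * (121 :: real) ^ (i + 1) = 1"
        by (simp_all only: i(1) flip: power_mult_distrib) simp_all
      moreover have "x * y = a * b * (x * y * c * e)" if "a * e = 1" "b * c = 1" for a b c e x y :: real
      proof -
        have "a * b * (x * y * c * e) = (a * e) * (b * c) * (x * y)" by (simp only: mult_ac)
        then show ?thesis using that by simp
      qed
      ultimately show ?thesis by (simp only: Suc_eq_plus1 add.assoc one_add_one)
    qed
    also have "\<dots> \<le> t ^ (4 * (K + 1)\<^sup>2) * (1 / 121) ^ K * (256 * real (i + 1) ^ 2) ^ (2 * i + 1)"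
      using tp factorial_growth[OF i(2)] t by (intro mult_mono) (auto simp del: of_nat_add)
    also have "\<dots> = t ^ (4 * (K + 1)\<^sup>2) * ((1 / 11) ^ K)\<^sup>2 * real (256 * K\<^sup>2) ^ (2 * i + 1)"
    proof -
      have "(1 / 121 :: real) ^ K = ((1 / 11) ^ K)\<^sup>2" for K
        by (simp add: power2_eq_square flip: power_mult_distrib)
      then show ?thesis by (simp only: i(1) of_nat_mult of_nat_power of_nat_numeral)
    qed
    finally show "fact (2 * i + 1) * fact (Suc (2 * i + 1))
        \<le> t ^ (4 * (K + 1)\<^sup>2) * ((1 / 11) ^ K)\<^sup>2 * real (256 * K\<^sup>2) ^ (2 * i + 1)" .
  qed auto
qed

lemma Q_le_q_medium:
  assumes d: "126 \<le> d" and m: "2 \<le> n div (d + 1)" "n div (d + 1) \<le> 149"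
  shows "Q d 2 n \<le> q d 2 n"
proof -
  \<comment> \<open>Two exact factors give \<open>3 / 8\<close>, the tail a further
    \<open>3 / 4\<close>.\<close>
  have p2: "9 / 32 \<le> (\<Prod>k<M. 1 - (1 / 2 :: real) ^ Suc k)" for M
    using prod_one_minus_power_ge[of "1 / 2" 2 M] by (simp add: eval_nat_numeral)
  have p4: "1 / 68 \<le> (\<Prod>k<M. 1 - (3 / 4 :: real) ^ Suc k)" for M
  proof -
    have "1 / 68 \<le> (\<Prod>k<8. 1 - (3 / 4 :: real) ^ Suc k) * (1 - (3 / 4) ^ Suc 8 / (1 - 3 / 4))"
      by (simp add: lessThan_nat_numeral lessThan_Suc power_divide)
    also have "\<dots> \<le> (\<Prod>k<M. 1 - (3 / 4 :: real) ^ Suc k)"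
      by (rule prod_one_minus_power_ge) auto
    finally show ?thesis .
  qed
  note block2 = Q_le_q_block[OF d _ _ _ p2]
  note block4 = Q_le_q_block[OF d _ _ _ p4]
  \<comment> \<open>Larger \<open>m\<close> calls for \<open>t\<close> closer to 1:
    \<open>1 / 2\<close> serves up to 24, \<open>3 / 4\<close> from 25 on. In each block
    \<open>a\<close> is the largest value \<open>Q_le_q_block\<close> permits.\<close>
  consider "n div (d + 1) = 2" | "n div (d + 1) = 3" | "n div (d + 1) \<in> {4..6}"
    | "n div (d + 1) \<in> {7..10}" | "n div (d + 1) \<in> {11..17}" | "n div (d + 1) \<in> {18..24}"
    | "n div (d + 1) \<in> {25..43}" | "n div (d + 1) \<in> {44..89}" | "n div (d + 1) \<in> {90..149}"
    using m unfolding atLeastAtMost_iff by linarith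
  then show ?thesis
  proof cases
    case 1
    then show ?thesis by (intro block2[where lo = 2 and hi = 2 and j = 1 and a = 124]) (auto simp: power2_eq_square)
  next
    case 2
    then show ?thesis by (intro block2[where lo = 3 and hi = 3 and j = 1 and a = 251]) (auto simp: power2_eq_square power_divide)
  next
    case 3
    then show ?thesis by (intro block2[where lo = 4 and hi = 6 and j = 2 and a = 124]) (auto simp: fact_numeral power_divide)
  next
    case 4
    then show ?thesis by (intro block2[where lo = 7 and hi = 10 and j = 2 and a = 505]) (auto simp: fact_numeral power_divide)
  next
    case 5
    then show ?thesis by (intro block2[where lo = 11 and hi = 17 and j = 3 and a = 633]) (auto simp: fact_numeral power_divide)
  next
    case 6
    then show ?thesis by (intro block2[where lo = 18 and hi = 24 and j = 4 and a = 1016]) (auto simp: fact_numeral power_divide)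
  next
    case 7
    then show ?thesis by (intro block4[where lo = 25 and hi = 43 and j = 5 and a = 1273]) (auto simp: fact_numeral power_divide)
  next
    case 8
    then show ?thesis by (intro block4[where lo = 44 and hi = 89 and j = 7 and a = 2044]) (auto simp: fact_numeral power_divide)
  next
    case 9
    then show ?thesis by (intro block4[where lo = 90 and hi = 149 and j = 10 and a = 4478]) (auto simp: fact_numeral power_divide)
  qed
qed

section \<open>Direct count for \<open>n < 2 * (d + 1)\<close>\<close>

text \<open>Total weight at most 1 leaves room for at most one part other than 2, namely
  \<open>d + 1\<close> or \<open>d + 5\<close>. The three terms stand for no such part,
  \<open>d + 1\<close> and \<open>d + 5\<close>; parity decides whether 2s can fill the
  rest.\<close>

lemma Q_small:
  assumes d: "2 \<le> d" and n: "n < 2 * (d + 1)"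
  shows "Q d 2 n \<le> of_bool (even n) + of_bool (d + 1 \<le> n \<and> even (n - (d + 1)))
    + of_bool (d + 5 \<le> n \<and> even (n - (d + 5)))"
proof -
  define m where "m = n div (d + 1)"
  have m1: "m \<le> 1" using n unfolding m_def by (metis One_nat_def less_Suc_eq_le less_mult_imp_div_less numeral_2_eq_2)
  define X where "X = {B. set_mset B \<subseteq> Q_parts d m \<and> (\<Sum>w\<in>#B. part_index d w) \<le> m
    \<and> \<Sum>\<^sub># B \<le> n \<and> even (n - \<Sum>\<^sub># B)}"
  have sub: "Q_parts d m \<subseteq> {d + 1, d + 5}"
  proof -
    have "Q_parts d m \<subseteq> Q_parts d 1" using m1 unfolding Q_parts_def by fastforce
    also have "\<dots> = {d + 1, d + 5}" by (auto simp: Q_parts_def lessThan_Suc)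
    finally show ?thesis .
  qed
  have "X \<subseteq> (if even n then {{#}} else {})
      \<union> (if d + 1 \<le> n \<and> even (n - (d + 1)) then {{#d + 1#}} else {})
      \<union> (if d + 5 \<le> n \<and> even (n - (d + 5)) then {{#d + 5#}} else {})" (is "_ \<subseteq> ?R")
  proof
    fix B assume B: "B \<in> X"
    then have B': "set_mset B \<subseteq> Q_parts d m" "(\<Sum>w\<in>#B. part_index d w) \<le> m"
      by (auto simp: X_def)
    have "size C \<le> (\<Sum>w\<in>#C. part_index d w)" if "set_mset C \<subseteq> Q_parts d m" for C
      using that
    proof (induction C)
      case (add w C)
      then show ?case using part_index_pos[OF d, of w m] by simp
    qed simp
    from this[OF B'(1)] have "size B \<le> 1" using B'(2) m1 by linarith
    then consider "B = {#}" | w where "B = {#w#}"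
      by (metis One_nat_def le_Suc_eq le_zero_eq size_1_singleton_mset size_eq_0_iff_empty)
    then show "B \<in> ?R" using B sub by cases (auto simp: X_def)
  qed
  then have "card X \<le> card ?R" by (intro card_mono) auto
  also have "\<dots> \<le> of_bool (even n) + of_bool (d + 1 \<le> n \<and> even (n - (d + 1)))
    + of_bool (d + 5 \<le> n \<and> even (n - (d + 5)))"
    by (intro order_trans[OF card_Un_le] add_mono) auto
  finally show ?thesis using Q_le_card[OF d, of n] unfolding X_def m_def by linarith
qed

lemma q_ge_card:
  assumes "\<And>P. P \<in> S \<Longrightarrow> \<exists>xs. P = mset xs \<and> sum_list xs = n \<and> (\<forall>x\<in>set xs. 2 \<le> x)
    \<and> sorted_wrt (\<lambda>x y. x + d \<le> y) xs"
  shows "card S \<le> q d 2 n"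
  unfolding q_def
proof (intro card_mono finite_q_set subsetI)
  fix P assume "P \<in> S"
  then obtain xs where xs: "P = mset xs" "sum_list xs = n" "\<forall>x\<in>set xs. 2 \<le> x"
    "sorted_wrt (\<lambda>x y. x + d \<le> y) xs" using assms by blast
  then show "P \<in> {P \<in> partitions n. (\<forall>x\<in>#P. 2 \<le> x) \<and> differ_by_at_least d P}"
    using differ_by_at_least_mset[OF xs(4)] by (force simp: partitions_def sum_mset_sum_list)
qed

text \<open>The witnesses are \<open>n\<close> alone (or the empty partition), then
  \<open>2, n - 2\<close>, then \<open>3, n - 3\<close>; a pair \<open>a, n - a\<close> has the
  required gap once \<open>2 * a + d <= n\<close>.\<close>

lemma q_small:
  shows "n \<noteq> 1 \<Longrightarrow> 1 \<le> q d 2 n" "d + 4 \<le> n \<Longrightarrow> 2 \<le> q d 2 n" "d + 6 \<le> n \<Longrightarrow> 3 \<le> q d 2 n"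
proof -
  define ok where "ok P \<longleftrightarrow> (\<exists>xs. P = mset xs \<and> sum_list xs = n \<and> (\<forall>x\<in>set xs. 2 \<le> x)
    \<and> sorted_wrt (\<lambda>x y. x + d \<le> y) xs)" for P
  have card_le: "card S \<le> q d 2 n" if "\<forall>P\<in>S. ok P" for S
    using that unfolding ok_def by (intro q_ge_card) blast
  have zero: "ok {#}" if "n = 0"
    unfolding ok_def using that by (intro exI[of _ "[]"]) auto
  have one: "ok {#n#}" if "2 \<le> n"
    unfolding ok_def using that by (intro exI[of _ "[n]"]) auto
  have two: "ok {#a, n - a#}" if "2 \<le> a" "2 * a + d \<le> n" for a
    unfolding ok_def using that by (intro exI[of _ "[a, n - a]"]) auto
  show "1 \<le> q d 2 n" if "n \<noteq> 1"
  proof (cases "n = 0")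
    case True
    then show ?thesis using card_le[of "{{#}}"] zero by simp
  next
    case False
    then show ?thesis using card_le[of "{{#n#}}"] one that by simp
  qed
  show "2 \<le> q d 2 n" if "d + 4 \<le> n"
    using card_le[of "{{#n#}, {#2, n - 2#}}"] one two[of 2] that by simp
  show "3 \<le> q d 2 n" if "d + 6 \<le> n"
  proof -
    have "{#2, n - 2#} \<noteq> {#3, n - 3#}"
    proof
      assume "{#2, n - 2#} = {#3, n - 3#}"
      then have "2 \<in># {#3, n - 3#}" by (metis union_single_eq_member)
      then have "n = 5" by auto
      then show False using that by simp
    qed
    then have "card {{#n#}, {#2, n - 2#}, {#3, n - 3#}} = 3" by simp
    then show ?thesis
      using card_le[of "{{#n#}, {#2, n - 2#}, {#3, n - 3#}}"] one two[of 2] two[of 3] that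
      by simp
  qed
qed

text \<open>Below \<open>d + 5\<close> the terms for no part and for \<open>d + 1\<close> can
  coincide only if \<open>d\<close> is odd and \<open>n\<close> is \<open>d + 1\<close> or
  \<open>d + 3\<close>. At \<open>d + 5\<close> with \<open>d\<close> even the first term vanishes,
  so \<open>Q <= 2\<close>. From \<open>d + 6\<close> on three partitions suffice.\<close>

lemma Q_le_q_small:
  assumes d: "2 \<le> d" and n: "n < 2 * (d + 1)"
    and exc: "\<not> (odd d \<and> n \<in> {d + 1, d + 3, d + 5})"
  shows "Q d 2 n \<le> q d 2 n"
proof -
  note Q = Q_small[OF d n]
  consider "n = 1" | "n \<noteq> 1" "n < d + 5" | "n = d + 5" | "d + 6 \<le> n" by linarith
  then show ?thesis
  proof cases
    case 1
    then show ?thesis using Q d by simp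
  next
    case 2
    have "\<not> (even n \<and> d + 1 \<le> n \<and> even (n - (d + 1)))"
    proof
      assume *: "even n \<and> d + 1 \<le> n \<and> even (n - (d + 1))"
      then have "odd d" by (auto simp: even_diff_nat)
      moreover have "n = d + 1 \<or> n = d + 2 \<or> n = d + 3 \<or> n = d + 4" using * 2 by linarith
      ultimately show False using * exc by auto
    qed
    then have "Q d 2 n \<le> 1" using Q 2 by (auto split: if_splits simp: of_bool_def)
    then show ?thesis using q_small(1)[OF 2(1), of d] by linarith
  next
    case 3
    then have "odd n" using exc by auto
    then have "Q d 2 n \<le> 2" using Q by (auto simp: of_bool_def split: if_splits)
    then show ?thesis using q_small(2)[of d n] 3 by linarith
  next
    case 4
    have "Q d 2 n \<le> 3" using Q by (auto simp: of_bool_def split: if_splits)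
    then show ?thesis using q_small(3)[OF 4] by linarith
  qed
qed

theorem theorem1p1:
  fixes d n :: nat
  assumes "d = 126 \<or> d \<ge> 253"
    and "\<not> (odd d \<and> n \<in> {d + 1, d + 3, d + 5})"
  shows "q d 2 n \<ge> Q d 2 n"
proof -
  have d: "126 \<le> d" using assms(1) by auto
  \<comment> \<open>The last range starts at \<open>144 = 4 * 6^2\<close>, the first value with
    \<open>K = 6\<close>, and overlaps the middle one.\<close>
  consider "n < 2 * (d + 1)" | "2 \<le> n div (d + 1)" "n div (d + 1) \<le> 149" | "144 \<le> n div (d + 1)"
  proof -
    have "n < 2 * (d + 1) \<or> 2 \<le> n div (d + 1)"
      by (simp add: less_eq_div_iff_mult_less_eq linorder_not_le[symmetric])
    then show thesis using that by linarith
  qed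
  then show ?thesis
  proof cases
    case 1
    then show ?thesis using d assms(2) by (intro Q_le_q_small) auto
  next
    case 2
    then show ?thesis using d by (intro Q_le_q_medium) auto
  next
    case 3
    then show ?thesis using d by (intro Q_le_q_large) auto
  qed
qed

end
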